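(* Let $1\leq p\leq\infty$ and let $T=T_{w,p}$ be a weighted bilateral shift for which there exists an integer $j\geq 2$ such that $T^j$ is cyclic. Then $T\oplus T$ is cyclic.
   Context: All vector spaces are over $\mathbb{C}$; $\mathbb{Z}_+$ is the set of non-negative integers. For a bounded sequence $w=\{w_n\}_{n\in\mathbb{Z}}$ of non-zero complex numbers, the weighted bilateral shift $T_{w,p}$ is the bounded linear operator acting on $\ell_p(\mathbb{Z})$ if $1\leq p<\infty$, and on $c_0(\mathbb{Z})$ if $p=\infty$, defined on the canonical basis by $T_{w,p}e_n=w_ne_{n-1}$ for $n\in\mathbb{Z}$. A bounded linear operator $T$ on a Banach space $\mathcal{B}$ is cyclic if there is $x\in\mathcal{B}$ such that the linear span of $\{T^nx:n\in\mathbb{Z}_+\}$ is dense in $\mathcal{B}$. $T\oplus T$ acts on $\mathcal{B}\oplus\mathcal{B}$ by $(x,y)\mapsto(Tx,Ty)$. *)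

theory Defs
  imports "HOL-Analysis.Analysis" "HOL-Library.Function_Algebras"
begin

text \<open>
  Since \<open>p\<close> is a parameter of the statement, the spaces are carrier sets inside the function
  space \<^typ>\<open>int \<Rightarrow> complex\<close>.  Addition on functions and on pairs is the library's
  pointwise one; complex scalar multiplication is given explicitly, because the library has no
  type class of complex vector spaces.
\<close>

definition seq_scale :: "complex \<Rightarrow> (int \<Rightarrow> complex) \<Rightarrow> (int \<Rightarrow> complex)" where
  "seq_scale c x = (\<lambda>n. c * x n)"

definition sum_scale :: "(complex \<Rightarrow> 'a \<Rightarrow> 'a) \<Rightarrow> complex \<Rightarrow> 'a \<times> 'a \<Rightarrow> 'a \<times> 'a" where
  "sum_scale s c = map_prod (s c) (s c)"

text \<open>For \<open>p = \<infinity>\<close> the space is \<open>c\<^sub>0(\<int>)\<close>, not \<open>\<ell>\<^sub>\<infinity>(\<int>)\<close>.\<close>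

definition lp_space :: "ereal \<Rightarrow> (int \<Rightarrow> complex) set" where
  "lp_space p =
    (if p = \<infinity> then {x. (x \<longlongrightarrow> 0) cofinite}
     else {x. (\<lambda>n. cmod (x n) powr real_of_ereal p) summable_on UNIV})"

text \<open>
  The value \<open>0\<close> off the space is only there because the library's metric space locale wants
  the distance function to be nonnegative also outside the carrier.
\<close>

definition lp_norm :: "ereal \<Rightarrow> (int \<Rightarrow> complex) \<Rightarrow> real" where
  "lp_norm p x =
    (if x \<notin> lp_space p then 0
     else if p = \<infinity> then (SUP n. cmod (x n))
     else (\<Sum>\<^sub>\<infinity>n. cmod (x n) powr real_of_ereal p) powr (1 / real_of_ereal p))"

definition lp_topology :: "ereal \<Rightarrow> (int \<Rightarrow> complex) topology" where
  "lp_topology p = Metric_space.mtopology (lp_space p) (\<lambda>x y. lp_norm p (x - y))"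

definition lp_bounded_operator :: "ereal \<Rightarrow> ((int \<Rightarrow> complex) \<Rightarrow> (int \<Rightarrow> complex)) \<Rightarrow> bool" where
  "lp_bounded_operator p T \<longleftrightarrow>
    T ` lp_space p \<subseteq> lp_space p \<and>
    (\<forall>x\<in>lp_space p. \<forall>y\<in>lp_space p. T (x + y) = T x + T y) \<and>
    (\<forall>c. \<forall>x\<in>lp_space p. T (seq_scale c x) = seq_scale c (T x)) \<and>
    (\<exists>K. \<forall>x\<in>lp_space p. lp_norm p (T x) \<le> K * lp_norm p x)"

definition basis_seq :: "int \<Rightarrow> (int \<Rightarrow> complex)" where
  "basis_seq n = (\<lambda>k. if k = n then 1 else 0)"

text \<open>
  This determines \<open>T\<close> on \<open>lp_space p\<close>, where the finitely supported sequences are dense;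
  the values of \<open>T\<close> outside the carrier are irrelevant.
\<close>

definition weighted_bilateral_shift ::
    "ereal \<Rightarrow> (int \<Rightarrow> complex) \<Rightarrow> ((int \<Rightarrow> complex) \<Rightarrow> (int \<Rightarrow> complex)) \<Rightarrow> bool" where
  "weighted_bilateral_shift p w T \<longleftrightarrow>
    bounded (range w) \<and> (\<forall>n. w n \<noteq> 0) \<and>
    lp_bounded_operator p T \<and>
    (\<forall>n. T (basis_seq n) = seq_scale (w n) (basis_seq (n - 1)))"

text \<open>
  Cyclicity depends only on the scalar multiplication and on the norm topology of the space, so
  on a direct sum the product topology can be used without choosing a norm.
\<close>

definition cyclic_operator ::
    "(complex \<Rightarrow> 'a \<Rightarrow> 'a::ab_group_add) \<Rightarrow> 'a topology \<Rightarrow> ('a \<Rightarrow> 'a) \<Rightarrow> bool" where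
  "cyclic_operator s X T \<longleftrightarrow>
    (\<exists>x\<in>topspace X. X closure_of (module.span s {(T ^^ n) x | n. True}) = topspace X)"

lemma vector_space_seq_scale: "vector_space seq_scale"
  by unfold_locales (auto simp: seq_scale_def fun_eq_iff algebra_simps)

lemma vector_space_sum_scale: "vector_space s \<Longrightarrow> vector_space (sum_scale s)"
  by (auto simp: vector_space_def sum_scale_def)

lemma c0_bdd_above:
  assumes "x \<in> lp_space \<infinity>"
  shows "bdd_above (range (\<lambda>n. cmod (x n)))"
proof -
  have "(x \<longlongrightarrow> 0) cofinite" using assms by (simp add: lp_space_def)
  then have "\<forall>\<^sub>F n in cofinite. cmod (x n) < 1"
    by (metis (no_types, lifting) dist_0_norm dist_commute eventually_mono tendstoD zero_less_one)
  then have fin: "finite {n. \<not> cmod (x n) < 1}" by (simp add: eventually_cofinite)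
  have "range (\<lambda>n. cmod (x n)) \<subseteq> {..1} \<union> (\<lambda>n. cmod (x n)) ` {n. \<not> cmod (x n) < 1}"
    by (auto simp: not_less)
  then show ?thesis
    using fin by (meson bdd_above_Iic bdd_above_Un bdd_above_finite bdd_above_mono finite_imageI)
qed

lemma lp_space_diff:
  assumes p: "1 \<le> p" and x: "x \<in> lp_space p" and y: "y \<in> lp_space p"
  shows "x - y \<in> lp_space p"
proof (cases "p = \<infinity>")
  case True
  then show ?thesis
    using x y tendsto_diff[of x 0 cofinite y 0] by (simp add: lp_space_def fun_diff_def)
next
  case False
  define q where "q = real_of_ereal p"
  have q: "q \<ge> 1" using p False unfolding q_def by (cases p) auto
  have "(\<lambda>n. 2 powr q * (cmod (x n) powr q + cmod (y n) powr q)) summable_on UNIV"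
    using x y False by (intro summable_on_cmult_right summable_on_add) (simp_all add: lp_space_def q_def)
  then have "(\<lambda>n. cmod (x n - y n) powr q) summable_on UNIV"
  proof (rule summable_on_comparison_test)
    fix n
    have "cmod (x n - y n) \<le> 2 * max (cmod (x n)) (cmod (y n))"
      using norm_triangle_ineq4[of "x n" "y n"] by linarith
    then have "cmod (x n - y n) powr q \<le> (2 * max (cmod (x n)) (cmod (y n))) powr q"
      using q by (intro powr_mono2) auto
    also have "\<dots> = 2 powr q * max (cmod (x n)) (cmod (y n)) powr q"
      by (rule powr_mult)
    also have "\<dots> \<le> 2 powr q * (cmod (x n) powr q + cmod (y n) powr q)"
      by (intro mult_left_mono) (auto simp: max_def)
    finally show "cmod (x n - y n) powr q \<le> 2 powr q * (cmod (x n) powr q + cmod (y n) powr q)" .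
  qed auto
  then show ?thesis using False by (simp add: lp_space_def q_def)
qed

lemma powr_convex_nonneg:
  fixes q :: real
  assumes q: "q \<ge> 1"
  shows "convex_on {0..} (\<lambda>t::real. t powr q)"
proof -
  have scale: "(t * u) powr q \<le> t * u powr q" if "0 \<le> t" "t \<le> 1" for t u :: real
  proof -
    have "t powr q \<le> t"
      using powr_mono'[of 1 q t] that q by (cases "t = 0") auto
    then show ?thesis by (simp add: powr_mult mult_right_mono)
  qed
  show ?thesis
  proof (rule convex_onI)
    fix t x y :: real
    assume t: "0 < t" "t < 1" and "x \<in> {0..}" "y \<in> {0..}"
    then consider "x = 0" | "y = 0" | "x \<in> {0<..}" "y \<in> {0<..}" by force
    then show "((1 - t) *\<^sub>R x + t *\<^sub>R y) powr q \<le> (1 - t) * x powr q + t * y powr q"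
    proof cases
      case 1
      then show ?thesis using scale[of t y] t by simp
    next
      case 2
      then show ?thesis using scale[of "1 - t" x] t by simp
    next
      case 3
      then show ?thesis using convex_onD[OF powr_convex[OF q], of t x y] t by simp
    qed
  qed simp
qed

lemma powr_add_le_convex:
  fixes a b A B q :: real
  assumes "a \<ge> 0" "b \<ge> 0" "A > 0" "B > 0" "q \<ge> 1"
  shows "(a + b) powr q \<le> (A + B) powr q * (A / (A + B) * (a powr q / A powr q)
           + B / (A + B) * (b powr q / B powr q))"
proof -
  have cvx: "convex_on {0..} (\<lambda>t::real. t powr q)" using assms(5) by (rule powr_convex_nonneg)
  have "(A / (A + B) * (a / A) + B / (A + B) * (b / B)) powr q
      \<le> A / (A + B) * (a / A) powr q + B / (A + B) * (b / B) powr q"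
    using assms convex_onD[OF cvx, of "B / (A + B)" "a / A" "b / B"]
    by (simp add: diff_divide_eq_iff)
  moreover have "a + b = (A + B) * (A / (A + B) * (a / A) + B / (A + B) * (b / B))"
  proof -
    have "A / (A + B) * (a / A) = a / (A + B)" "B / (A + B) * (b / B) = b / (A + B)"
      using assms by auto
    then show ?thesis using assms by (simp add: add_divide_distrib[symmetric])
  qed
  then have "(a + b) powr q = (A + B) powr q * (A / (A + B) * (a / A) + B / (A + B) * (b / B)) powr q"
    using assms by (metis add_nonneg_nonneg less_imp_le mult_nonneg_nonneg divide_nonneg_nonneg powr_mult)
  ultimately show ?thesis
    using assms by (simp add: powr_divide mult_left_mono)
qed

lemma lp_norm_nonneg: "0 \<le> lp_norm p x"
proof (cases "x \<in> lp_space p \<and> p = \<infinity>")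
  case True
  then have "cmod (x 0) \<le> (SUP n. cmod (x n))"
    by (intro cSUP_upper c0_bdd_above) auto
  then show ?thesis using True order_trans[OF norm_ge_zero[of "x 0"]] by (simp add: lp_norm_def)
qed (auto simp: lp_norm_def)

lemma lp_norm_minus: "lp_norm p (x - y) = lp_norm p (y - x)"
proof -
  have "(y - x \<in> lp_space p) = (x - y \<in> lp_space p)"
    using tendsto_minus[of "x - y" 0 cofinite] tendsto_minus[of "y - x" 0 cofinite]
    by (auto simp: lp_space_def norm_minus_commute fun_diff_def)
  then show ?thesis by (simp add: lp_norm_def norm_minus_commute)
qed

lemma lp_norm_powr:
  assumes "1 \<le> p" "p \<noteq> \<infinity>" "x \<in> lp_space p"
  shows "((\<lambda>n. cmod (x n) powr real_of_ereal p) has_sum lp_norm p x powr real_of_ereal p) UNIV"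
proof -
  have q: "real_of_ereal p \<ge> 1" using assms by (cases p) auto
  have "lp_norm p x powr real_of_ereal p = (\<Sum>\<^sub>\<infinity>n. cmod (x n) powr real_of_ereal p)"
    using q assms by (simp add: lp_norm_def powr_powr infsum_nonneg)
  then show ?thesis using assms by (simp add: lp_space_def)
qed

lemma lp_norm_eq_0:
  assumes p: "1 \<le> p" and x: "x \<in> lp_space p"
  shows "lp_norm p x = 0 \<longleftrightarrow> x = 0"
proof
  assume 0: "lp_norm p x = 0"
  show "x = 0"
  proof (cases "p = \<infinity>")
    case True
    then have "cmod (x n) \<le> 0" for n
      using cSUP_upper[OF UNIV_I c0_bdd_above, of x n] x 0 by (simp add: lp_norm_def)
    then show ?thesis by auto
  next
    case False
    have "((\<lambda>n. cmod (x n) powr real_of_ereal p) has_sum 0) UNIV"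
      using lp_norm_powr[OF p False x] 0 p by simp
    then have "cmod (x n) powr real_of_ereal p = 0" for n
      using nonneg_has_sum_le_0D[of _ UNIV 0 n] by fastforce
    then show ?thesis by auto
  qed
next
  assume "x = 0"
  then show "lp_norm p x = 0" by (simp add: lp_norm_def)
qed

lemma lp_norm_triangle:
  assumes p: "1 \<le> p" and x: "x \<in> lp_space p" and y: "y \<in> lp_space p" and z: "x + y \<in> lp_space p"
  shows "lp_norm p (x + y) \<le> lp_norm p x + lp_norm p y"
proof (cases "p = \<infinity>")
  case True
  have "cmod (x n + y n) \<le> (SUP n. cmod (x n)) + (SUP n. cmod (y n))" for n
    using cSUP_upper[OF UNIV_I c0_bdd_above, of x n] cSUP_upper[OF UNIV_I c0_bdd_above, of y n]
      norm_triangle_ineq[of "x n" "y n"] x y True by simp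
  then show ?thesis
    using True x y z by (auto simp: lp_norm_def intro!: cSUP_least)
next
  case False
  define q where "q = real_of_ereal p"
  have q: "q \<ge> 1" using p False unfolding q_def by (cases p) auto
  define A B where "A = lp_norm p x" and "B = lp_norm p y"
  consider "A = 0" | "B = 0" | "A > 0" "B > 0"
    using lp_norm_nonneg[of p x] lp_norm_nonneg[of p y] unfolding A_def B_def by linarith
  then show ?thesis
  proof cases
    case 1
    then show ?thesis using lp_norm_eq_0[OF p x] by (simp add: A_def)
  next
    case 2
    then show ?thesis using lp_norm_eq_0[OF p y] by (simp add: B_def)
  next
    case 3
    have hx: "((\<lambda>n. cmod (x n) powr q) has_sum A powr q) UNIV"
      and hy: "((\<lambda>n. cmod (y n) powr q) has_sum B powr q) UNIV"
      and hz: "((\<lambda>n. cmod (x n + y n) powr q) has_sum lp_norm p (x + y) powr q) UNIV"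
      using lp_norm_powr[OF p False x] lp_norm_powr[OF p False y] lp_norm_powr[OF p False z]
      by (simp_all add: A_def B_def q_def)
    have "((\<lambda>n. (A + B) powr q * (A / (A + B) * (cmod (x n) powr q / A powr q)
           + B / (A + B) * (cmod (y n) powr q / B powr q))) has_sum
           (A + B) powr q * (A / (A + B) * (A powr q / A powr q)
           + B / (A + B) * (B powr q / B powr q))) UNIV"
      by (intro has_sum_cmult_right has_sum_add has_sum_divide_const hx hy)
    moreover have "cmod (x n + y n) powr q \<le> (A + B) powr q *
        (A / (A + B) * (cmod (x n) powr q / A powr q)
           + B / (A + B) * (cmod (y n) powr q / B powr q))" for n
    proof -
      have "cmod (x n + y n) powr q \<le> (cmod (x n) + cmod (y n)) powr q"
        using q by (intro powr_mono2 norm_triangle_ineq) auto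
      also note powr_add_le_convex[OF norm_ge_zero norm_ge_zero 3 q]
      finally show ?thesis .
    qed
    ultimately have "lp_norm p (x + y) powr q \<le> (A + B) powr q * (A / (A + B) * (A powr q / A powr q)
           + B / (A + B) * (B powr q / B powr q))"
      using has_sum_mono[OF hz] by blast
    also have "\<dots> = (A + B) powr q"
      using 3 by (simp add: add_divide_distrib[symmetric])
    finally show ?thesis
      using 3 q lp_norm_nonneg[of p "x + y"] unfolding A_def[symmetric] B_def[symmetric]
      by (metis add_pos_pos less_le_not_le linorder_le_less_linear order_less_le_trans powr_less_mono2 zero_less_one less_imp_le)
  qed
qed

lemma Metric_space_lp:
  assumes p: "1 \<le> p"
  shows "Metric_space (lp_space p) (\<lambda>x y. lp_norm p (x - y))"
proof
  fix x y z
  show "0 \<le> lp_norm p (x - y)" by (rule lp_norm_nonneg)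
  show "lp_norm p (x - y) = lp_norm p (y - x)" by (rule lp_norm_minus)
  assume x: "x \<in> lp_space p" and y: "y \<in> lp_space p"
  show "lp_norm p (x - y) = 0 \<longleftrightarrow> x = y"
    using lp_norm_eq_0[OF p lp_space_diff[OF p x y]] by simp
  assume z: "z \<in> lp_space p"
  have "(x - y) + (y - z) = x - z" by simp
  then show "lp_norm p (x - z) \<le> lp_norm p (x - y) + lp_norm p (y - z)"
    using lp_norm_triangle[OF p lp_space_diff[OF p x y] lp_space_diff[OF p y z]]
      lp_space_diff[OF p x z] by simp
qed

lemma topspace_lp_topology: "1 \<le> p \<Longrightarrow> topspace (lp_topology p) = lp_space p"
  by (simp add: lp_topology_def Metric_space.topspace_mtopology Metric_space_lp)

end

theory Submission
  imports Defs
begin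

text \<open>
  Let \<open>x\<close> be a cyclic vector of \<open>T ^^ j\<close>, let \<open>\<omega> \<noteq> 1\<close> be a \<open>j\<close>-th root of unity, and let \<open>D\<close>
  be the diagonal isometry \<open>D e\<^sub>n = \<omega>\<^sup>n e\<^sub>n\<close>.  As \<open>T\<close> lowers the index by one, \<open>T D = \<omega> D T\<close>
  (\<open>bilateral_shift_rotate_coords\<close>): a bilateral shift is isometrically similar to each of its
  rotations.  The claim is that \<open>(x, D x)\<close> is cyclic for \<open>T \<oplus> T\<close>.

  The \<open>m\<close>-th element of its orbit is \<open>(T\<^sup>m x, \<omega>\<^sup>m D T\<^sup>m x)\<close>, and because \<open>\<omega>\<^sup>j = 1\<close> the factor
  \<open>\<omega>\<^sup>m\<close> depends only on the residue of \<open>m\<close> modulo \<open>j\<close>.  The residues \<open>0\<close> and \<open>1\<close> put all pairs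
  \<open>(q, D q)\<close> and \<open>(T q, \<omega> D T q)\<close>, with \<open>q\<close> in the span of the orbit of \<open>x\<close> under \<open>T ^^ j\<close>, into
  the span of the orbit of \<open>(x, D x)\<close> (\<open>orbit_span_pairs\<close>).  Such \<open>q\<close> are dense, and so are the
  \<open>T q\<close>, because all weights are non-zero and hence \<open>T\<close> has dense range
  (\<open>bilateral_shift_image_dense\<close>).  The closed span therefore contains \<open>(y, D y)\<close> and
  \<open>(u, \<omega> D u)\<close> for all \<open>y\<close> and \<open>u\<close>.  Since \<open>D\<close> is invertible and \<open>\<omega> \<noteq> 1\<close>, every pair
  \<open>(a, b)\<close> is a sum of two such pairs: \<open>y + u = a\<close> and \<open>y + \<omega> u = D\<^sup>-\<^sup>1 b\<close> can be solved.
\<close>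

section \<open>Sequences in the space\<close>

text \<open>
  Both spaces are solid: membership and norm depend monotonically on the moduli of the
  coordinates.  This settles scalar multiples and diagonal isometries for all \<open>p\<close> at once.
\<close>

lemma lp_space_lp_norm_dominated:
  assumes p: "1 \<le> p" and x: "x \<in> lp_space p" and c: "0 \<le> c"
    and le: "\<And>n. cmod (y n) \<le> c * cmod (x n)"
  shows lp_space_dominated: "y \<in> lp_space p"
    and lp_norm_dominated: "lp_norm p y \<le> c * lp_norm p x"
proof -
  have "y \<in> lp_space p \<and> lp_norm p y \<le> c * lp_norm p x"
  proof (cases "p = \<infinity>")
    case True
    have "((\<lambda>n. c * cmod (x n)) \<longlongrightarrow> 0) cofinite"
      using x True by (intro tendsto_mult_right_zero tendsto_norm_zero) (simp add: lp_space_def)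
    then have y: "y \<in> lp_space p"
      using Lim_null_comparison[of y "\<lambda>n. c * cmod (x n)" cofinite] le True
      by (simp add: lp_space_def)
    have "cmod (y n) \<le> c * (SUP n. cmod (x n))" for n
      using cSUP_upper[OF UNIV_I c0_bdd_above, of x n] x True c
      by (intro order_trans[OF le] mult_left_mono) auto
    then show ?thesis
      using y x True by (auto simp: lp_norm_def intro!: cSUP_least)
  next
    case False
    define q where "q = real_of_ereal p"
    have q: "q \<ge> 1" using p False unfolding q_def by (cases p) auto
    have hx: "((\<lambda>n. c powr q * cmod (x n) powr q) has_sum c powr q * lp_norm p x powr q) UNIV"
      using lp_norm_powr[OF p False x] unfolding q_def by (intro has_sum_cmult_right)
    have le': "cmod (y n) powr q \<le> c powr q * cmod (x n) powr q" for n
      using q le[of n] by (subst powr_mult[symmetric]) (intro powr_mono2, auto)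
    have "(\<lambda>n. cmod (y n) powr q) summable_on UNIV"
      using has_sum_imp_summable[OF hx] le' by (rule summable_on_comparison_test) auto
    then have y: "y \<in> lp_space p" using False by (simp add: lp_space_def q_def)
    have "lp_norm p y powr q \<le> c powr q * lp_norm p x powr q"
      using has_sum_mono[OF _ hx le'] lp_norm_powr[OF p False y] unfolding q_def by blast
    also have "\<dots> = (c * lp_norm p x) powr q"
      by (rule powr_mult[symmetric])
    finally have "lp_norm p y \<le> c * lp_norm p x"
      using q lp_norm_nonneg c
      by (metis mult_nonneg_nonneg not_le order_less_le_trans powr_less_mono2 zero_less_one)
    with y show ?thesis by blast
  qed
  then show "y \<in> lp_space p" "lp_norm p y \<le> c * lp_norm p x" by blast+
qed

lemma lp_space_scale:
  assumes "1 \<le> p" "x \<in> lp_space p"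
  shows "seq_scale c x \<in> lp_space p"
  by (rule lp_space_dominated[OF assms, of "cmod c"]) (auto simp: seq_scale_def norm_mult)

lemma lp_space_finite_support:
  assumes "finite F" "\<And>n. n \<notin> F \<Longrightarrow> x n = 0"
  shows "x \<in> lp_space p"
proof (cases "p = \<infinity>")
  case True
  have "finite {n. x n \<noteq> 0}"
    using assms by (metis (mono_tags, lifting) finite_subset mem_Collect_eq subsetI)
  then have "\<forall>\<^sub>F n in cofinite. x n = 0" by (simp add: eventually_cofinite)
  then show ?thesis using True tendsto_eventually by (simp add: lp_space_def)
next
  case False
  have "(\<lambda>n. cmod (x n) powr real_of_ereal p) summable_on F" using assms by simp
  also have "?this \<longleftrightarrow> (\<lambda>n. cmod (x n) powr real_of_ereal p) summable_on UNIV"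
    using assms by (intro summable_on_cong_neutral) auto
  finally show ?thesis using False by (simp add: lp_space_def)
qed

lemma lp_space_add:
  assumes "1 \<le> p" "x \<in> lp_space p" "y \<in> lp_space p"
  shows "x + y \<in> lp_space p"
proof -
  have "0 \<in> lp_space p" by (rule lp_space_finite_support[of "{}"]) auto
  then have "0 - y \<in> lp_space p" using assms(1,3) by (intro lp_space_diff) auto
  then have "x - (0 - y) \<in> lp_space p" by (rule lp_space_diff[OF assms(1,2)])
  then show ?thesis by simp
qed

lemma cmod_le_lp_norm:
  assumes p: "1 \<le> p" and x: "x \<in> lp_space p"
  shows "cmod (x n) \<le> lp_norm p x"
proof (cases "p = \<infinity>")
  case True
  then show ?thesis
    using cSUP_upper[OF UNIV_I c0_bdd_above, of x n] x by (simp add: lp_norm_def)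
next
  case False
  define q where "q = real_of_ereal p"
  have q: "q \<ge> 1" using p False unfolding q_def by (cases p) auto
  have "sum (\<lambda>n. cmod (x n) powr q) {n} \<le> lp_norm p x powr q"
    by (rule finite_sum_le_has_sum[OF lp_norm_powr[OF p False x, folded q_def]]) auto
  then show ?thesis
    using q lp_norm_nonneg[of p x] powr_less_mono2[of q "lp_norm p x" "cmod (x n)"]
    by (intro leI) auto
qed

lemma finite_support_dense:
  assumes p: "1 \<le> p" and x: "x \<in> lp_space p" and e: "0 < e"
  obtains F where "finite F" "lp_norm p (x - (\<lambda>n. if n \<in> F then x n else 0)) < e"
proof (cases "p = \<infinity>")
  case True
  define F where "F = {n. \<not> cmod (x n) < e / 2}"
  define y where "y = x - (\<lambda>n. if n \<in> F then x n else 0)"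
  have "\<forall>\<^sub>F n in cofinite. cmod (x n) < e / 2"
    using x True e tendstoD[of x 0 cofinite "e / 2"] by (simp add: lp_space_def)
  then have F: "finite F" by (simp add: eventually_cofinite F_def)
  have y: "y \<in> lp_space p"
    using F unfolding y_def by (intro lp_space_diff p x lp_space_finite_support[of F]) auto
  have "cmod (y n) \<le> e / 2" for n using e by (auto simp: y_def F_def)
  then have "(SUP n. cmod (y n)) \<le> e / 2" by (intro cSUP_least) auto
  then have "lp_norm p y \<le> e / 2" using y True by (simp add: lp_norm_def)
  then show ?thesis using that[OF F] e by (simp add: y_def)
next
  case False
  define q where "q = real_of_ereal p"
  have q: "q \<ge> 1" using p False unfolding q_def by (cases p) auto
  define f where "f = (\<lambda>n. cmod (x n) powr q)"
  have hx: "(f has_sum lp_norm p x powr q) UNIV"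
    using lp_norm_powr[OF p False x] by (simp add: f_def q_def)
  have "(e / 2) powr q > 0" using e by simp
  then obtain F where F: "finite F" "dist (sum f F) (infsum f UNIV) \<le> (e / 2) powr q"
    using infsum_finite_approximation[OF has_sum_imp_summable[OF hx]] by metis
  define y where "y = x - (\<lambda>n. if n \<in> F then x n else 0)"
  have y: "y \<in> lp_space p"
    using F unfolding y_def by (intro lp_space_diff p x lp_space_finite_support[of F]) auto
  have "(f has_sum (lp_norm p x powr q - sum f F)) (UNIV - F)"
    by (intro has_sum_Diff hx has_sum_finite F) auto
  moreover have "(f has_sum lp_norm p y powr q) (UNIV - F)"
  proof -
    have "((\<lambda>n. cmod (y n) powr q) has_sum lp_norm p y powr q) UNIV"
      using lp_norm_powr[OF p False y] by (simp add: q_def)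
    also have "?this \<longleftrightarrow> (f has_sum lp_norm p y powr q) (UNIV - F)"
      by (intro has_sum_cong_neutral) (auto simp: y_def f_def)
    finally show ?thesis .
  qed
  ultimately have "lp_norm p y powr q = lp_norm p x powr q - sum f F"
    using has_sum_unique by blast
  also have "\<dots> \<le> (e / 2) powr q"
    using F(2) infsumI[OF hx] by (auto simp: dist_real_def)
  finally have "lp_norm p y \<le> e / 2"
    using q e powr_less_mono2[of q "e / 2" "lp_norm p y"] by linarith
  then show ?thesis using that[OF F(1)] e by (simp add: y_def)
qed

section \<open>The shift in coordinates\<close>

lemma lp_bounded_operator_pos_bound:
  assumes "lp_bounded_operator p T"
  obtains K where "K > 0" "\<And>x. x \<in> lp_space p \<Longrightarrow> lp_norm p (T x) \<le> K * lp_norm p x"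
proof -
  obtain K where K: "\<And>x. x \<in> lp_space p \<Longrightarrow> lp_norm p (T x) \<le> K * lp_norm p x"
    using assms unfolding lp_bounded_operator_def by blast
  have "lp_norm p (T x) \<le> max K 1 * lp_norm p x" if "x \<in> lp_space p" for x
    using K[OF that] mult_right_mono[OF max.cobounded1[of K 1] lp_norm_nonneg[of p x]] by linarith
  then show ?thesis using that[of "max K 1"] by simp
qed

lemma lp_bounded_operator_diff:
  assumes p: "1 \<le> p" and T: "lp_bounded_operator p T"
    and x: "x \<in> lp_space p" and y: "y \<in> lp_space p"
  shows "T (x - y) = T x - T y"
proof -
  have "T ((x - y) + y) = T (x - y) + T y"
    using T lp_space_diff[OF p x y] y unfolding lp_bounded_operator_def by blast
  then show ?thesis by simp
qed

text \<open>
  The action on the basis determines the operator on the span of the basis, and by continuity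
  and density everywhere; this gives the coordinate formula of the next two lemmas.
\<close>

lemma bilateral_shift_finite_support:
  assumes p: "1 \<le> p" and T: "weighted_bilateral_shift p w T"
  shows "finite F \<Longrightarrow> (\<And>n. n \<notin> F \<Longrightarrow> x n = 0) \<Longrightarrow> T x = (\<lambda>n. w (n + 1) * x (n + 1))"
proof (induction F arbitrary: x rule: finite_induct)
  case empty
  have 0: "seq_scale 0 x = x" using empty by (auto simp: seq_scale_def)
  have "T (seq_scale 0 x) = seq_scale 0 (T x)"
    using T empty lp_space_finite_support[of "{}" x p]
    unfolding weighted_bilateral_shift_def lp_bounded_operator_def by auto
  then show ?case using empty 0 by (auto simp: seq_scale_def)
next
  case (insert a F)
  define y where "y = x(a := 0)"
  have y: "y n = 0" if "n \<notin> F" for n using insert.prems that by (auto simp: y_def)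
  have yin: "y \<in> lp_space p" using insert.hyps(1) y by (rule lp_space_finite_support)
  have bin: "basis_seq a \<in> lp_space p"
    by (rule lp_space_finite_support[of "{a}"]) (auto simp: basis_seq_def)
  have sin: "seq_scale (x a) (basis_seq a) \<in> lp_space p" by (rule lp_space_scale[OF p bin])
  have split: "x = y + seq_scale (x a) (basis_seq a)"
    by (auto simp: y_def seq_scale_def basis_seq_def fun_eq_iff)
  have "T x = T y + seq_scale (x a) (T (basis_seq a))"
    using T yin bin sin
    by (subst split) (simp add: weighted_bilateral_shift_def lp_bounded_operator_def)
  also have "\<dots> = (\<lambda>n. w (n + 1) * y (n + 1)) + seq_scale (x a) (seq_scale (w a) (basis_seq (a - 1)))"
    using T insert.IH[OF y] by (simp add: weighted_bilateral_shift_def)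
  also have "\<dots> = (\<lambda>n. w (n + 1) * x (n + 1))"
    by (auto simp: y_def seq_scale_def basis_seq_def fun_eq_iff)
  finally show ?case .
qed

lemma bilateral_shift_apply:
  assumes p: "1 \<le> p" and T: "weighted_bilateral_shift p w T" and x: "x \<in> lp_space p"
  shows "T x n = w (n + 1) * x (n + 1)"
proof -
  have B: "lp_bounded_operator p T" using T by (simp add: weighted_bilateral_shift_def)
  obtain K where K: "K > 0" "\<And>x. x \<in> lp_space p \<Longrightarrow> lp_norm p (T x) \<le> K * lp_norm p x"
    using lp_bounded_operator_pos_bound[OF B] by blast
  \<comment> \<open>The two sides agree on a truncation of \<open>x\<close> at distance less than \<open>e\<close>, and at a fixed \<open>n\<close>
    both are Lipschitz in \<open>x\<close>, with constants \<open>K\<close> and the modulus of the weight.\<close>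
  have "cmod (T x n - w (n + 1) * x (n + 1)) \<le> (K + cmod (w (n + 1))) * e" if e: "e > 0" for e
  proof -
    obtain F where F: "finite F" "lp_norm p (x - (\<lambda>n. if n \<in> F then x n else 0)) < e"
      using finite_support_dense[OF p x e] by blast
    define y where "y = (\<lambda>n. if n \<in> F then x n else 0)"
    have y: "y \<in> lp_space p"
      using F(1) by (rule lp_space_finite_support) (simp add: y_def)
    have d: "x - y \<in> lp_space p" by (rule lp_space_diff[OF p x y])
    have Td: "T (x - y) \<in> lp_space p" using B d unfolding lp_bounded_operator_def by blast
    have Ty: "T y n = w (n + 1) * y (n + 1)"
      by (subst bilateral_shift_finite_support[OF p T F(1)]) (simp_all add: y_def)
    have "cmod (T x n - w (n + 1) * x (n + 1))
        = cmod (T (x - y) n - w (n + 1) * (x - y) (n + 1))"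
      by (simp add: lp_bounded_operator_diff[OF p B x y] Ty algebra_simps)
    also have "\<dots> \<le> cmod (T (x - y) n) + cmod (w (n + 1)) * cmod ((x - y) (n + 1))"
      by (metis norm_mult norm_triangle_ineq4)
    also have "\<dots> \<le> lp_norm p (T (x - y)) + cmod (w (n + 1)) * lp_norm p (x - y)"
      by (intro add_mono mult_left_mono cmod_le_lp_norm[OF p d] cmod_le_lp_norm[OF p Td]) auto
    also have "\<dots> \<le> (K + cmod (w (n + 1))) * lp_norm p (x - y)"
      using K(2)[OF d] by (simp add: algebra_simps)
    also have "\<dots> \<le> (K + cmod (w (n + 1))) * e"
      using F(2) K(1) by (intro mult_left_mono) (auto simp: y_def)
    finally show ?thesis .
  qed
  note bound = this
  have pos: "K + cmod (w (n + 1)) > 0" using K(1) by (simp add: add_pos_nonneg)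
  have "cmod (T x n - w (n + 1) * x (n + 1)) \<le> 0 + e" if "e > 0" for e
    using bound[of "e / (K + cmod (w (n + 1)))"] pos that by simp
  then have "cmod (T x n - w (n + 1) * x (n + 1)) \<le> 0" by (rule field_le_epsilon)
  then show ?thesis by simp
qed

text \<open>
  Since no weight vanishes, every finitely supported sequence has a preimage, obtained by
  shifting back and dividing by the weights.
\<close>

lemma bilateral_shift_dense_range:
  assumes p: "1 \<le> p" and T: "weighted_bilateral_shift p w T"
    and u: "u \<in> lp_space p" and e: "0 < e"
  obtains z where "z \<in> lp_space p" "lp_norm p (u - T z) < e"
proof -
  obtain F where F: "finite F" "lp_norm p (u - (\<lambda>n. if n \<in> F then u n else 0)) < e"
    using finite_support_dense[OF p u e] by blast
  define z where "z = (\<lambda>n. (if n - 1 \<in> F then u (n - 1) else 0) / w n)"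
  have z: "z \<in> lp_space p"
  proof (rule lp_space_finite_support)
    show "finite ((\<lambda>n. n + 1) ` F)" using F(1) by simp
    show "z n = 0" if "n \<notin> (\<lambda>n. n + 1) ` F" for n
      using that by (force simp: z_def image_iff)
  qed
  have "T z = (\<lambda>n. if n \<in> F then u n else 0)"
  proof
    fix n
    have "T z n = w (n + 1) * z (n + 1)" by (rule bilateral_shift_apply[OF p T z])
    then show "T z n = (if n \<in> F then u n else 0)"
      using T by (simp add: z_def weighted_bilateral_shift_def)
  qed
  then show ?thesis using that[OF z] F(2) by simp
qed

section \<open>Rotation of the coordinates\<close>

definition rotate_coords :: "complex \<Rightarrow> (int \<Rightarrow> complex) \<Rightarrow> (int \<Rightarrow> complex)" where
  "rotate_coords \<omega> x = (\<lambda>n. \<omega> powi n * x n)"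

lemma rotate_coords_add: "rotate_coords \<omega> (x + y) = rotate_coords \<omega> x + rotate_coords \<omega> y"
  and rotate_coords_diff: "rotate_coords \<omega> (x - y) = rotate_coords \<omega> x - rotate_coords \<omega> y"
  and rotate_coords_scale: "rotate_coords \<omega> (seq_scale c x) = seq_scale c (rotate_coords \<omega> x)"
  by (simp_all add: rotate_coords_def seq_scale_def fun_eq_iff algebra_simps)

lemma rotate_coords_inverse:
  assumes "\<omega> \<noteq> 0"
  shows "rotate_coords \<omega> (rotate_coords (inverse \<omega>) x) = x"
  using assms by (simp add: rotate_coords_def fun_eq_iff power_int_inverse)

lemma
  assumes "cmod \<omega> = 1" "1 \<le> p" "x \<in> lp_space p"
  shows rotate_coords_lp_space: "rotate_coords \<omega> x \<in> lp_space p"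
    and rotate_coords_lp_norm_le: "lp_norm p (rotate_coords \<omega> x) \<le> lp_norm p x"
  using lp_space_lp_norm_dominated[OF assms(2,3), of 1 "rotate_coords \<omega> x"] assms(1)
  by (auto simp: rotate_coords_def norm_mult norm_power_int)

text \<open>
  Both sides pick up the weight of the same step; the rotation is read off at index \<open>n + 1\<close> on
  the left and at index \<open>n\<close> on the right, which accounts for the factor \<open>\<omega>\<close>.
\<close>

lemma bilateral_shift_rotate_coords:
  assumes p: "1 \<le> p" and T: "weighted_bilateral_shift p w T" and \<omega>: "cmod \<omega> = 1"
    and x: "x \<in> lp_space p"
  shows "T (rotate_coords \<omega> x) = seq_scale \<omega> (rotate_coords \<omega> (T x))"
proof -
  have "\<omega> \<noteq> 0" using \<omega> by auto
  then show ?thesis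
    using bilateral_shift_apply[OF p T x]
      bilateral_shift_apply[OF p T rotate_coords_lp_space[OF \<omega> p x]]
    by (simp add: fun_eq_iff rotate_coords_def seq_scale_def power_int_add mult_ac)
qed

lemma bilateral_shift_power_lp_space:
  assumes T: "weighted_bilateral_shift p w T" and x: "x \<in> lp_space p"
  shows "(T ^^ n) x \<in> lp_space p"
  using T x
  by (induction n) (auto simp: weighted_bilateral_shift_def lp_bounded_operator_def)

lemma bilateral_shift_power_rotate_coords:
  assumes p: "1 \<le> p" and T: "weighted_bilateral_shift p w T" and \<omega>: "cmod \<omega> = 1"
    and x: "x \<in> lp_space p"
  shows "(T ^^ n) (rotate_coords \<omega> x) = seq_scale (\<omega> ^ n) (rotate_coords \<omega> ((T ^^ n) x))"
proof (induction n)
  case (Suc n)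
  have "(T ^^ Suc n) (rotate_coords \<omega> x) = seq_scale (\<omega> ^ n) (T (rotate_coords \<omega> ((T ^^ n) x)))"
    using T rotate_coords_lp_space[OF \<omega> p bilateral_shift_power_lp_space[OF T x]] Suc
    by (simp add: weighted_bilateral_shift_def lp_bounded_operator_def)
  also have "\<dots> = seq_scale (\<omega> ^ Suc n) (rotate_coords \<omega> ((T ^^ Suc n) x))"
    using bilateral_shift_rotate_coords[OF p T \<omega> bilateral_shift_power_lp_space[OF T x, of n]]
    by (simp add: seq_scale_def mult_ac)
  finally show ?case .
qed (simp add: seq_scale_def)

section \<open>Cyclicity of the direct sum\<close>

lemma map_prod_funpow:
  fixes f :: "'a \<Rightarrow> 'a" and g :: "'b \<Rightarrow> 'b"
  shows "map_prod f g ^^ n = map_prod (f ^^ n) (g ^^ n)"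
  by (induction n) (simp_all add: fun_eq_iff)

text \<open>
  The span of the orbit under \<open>T ^^ j\<close> is generated by the powers \<open>T ^^ (j * n)\<close>.  At these
  exponents, and at their successors, the factor \<open>\<omega> ^ m\<close> in the orbit of the pair is constant,
  namely \<open>1\<close> and \<open>\<omega>\<close>, so both relations survive linear combinations.
\<close>

lemma orbit_span_pairs:
  assumes p: "1 \<le> p" and T: "weighted_bilateral_shift p w T"
    and \<omega>: "cmod \<omega> = 1" "\<omega> ^ j = 1" and x: "x \<in> lp_space p"
    and q: "q \<in> module.span seq_scale {((T ^^ j) ^^ n) x | n. True}"
  defines "M \<equiv> module.span (sum_scale seq_scale)
                  {(map_prod T T ^^ n) (x, rotate_coords \<omega> x) | n. True}"
  shows "q \<in> lp_space p \<and> (q, rotate_coords \<omega> q) \<in> M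
    \<and> (T q, seq_scale \<omega> (rotate_coords \<omega> (T q))) \<in> M"
proof -
  interpret V: vector_space seq_scale by (rule vector_space_seq_scale)
  interpret W: vector_space "sum_scale seq_scale"
    by (rule vector_space_sum_scale[OF vector_space_seq_scale])
  have gen: "((T ^^ n) x, seq_scale (\<omega> ^ n) (rotate_coords \<omega> ((T ^^ n) x))) \<in> M" for n
    using bilateral_shift_power_rotate_coords[OF p T \<omega>(1) x, of n] unfolding M_def
    by (intro W.span_base) (auto simp: map_prod_funpow)
  have orbit: "((T ^^ j) ^^ n) x = (T ^^ (j * n)) x" for n by (simp add: funpow_mult)
  have B: "lp_bounded_operator p T" using T by (simp add: weighted_bilateral_shift_def)
  show ?thesis
    using q
  proof (induction rule: V.span_induct_alt)
    case base
    have "T 0 = 0"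
      using lp_bounded_operator_diff[OF p B x x] by simp
    then show ?case
      using W.span_zero unfolding M_def
      by (auto simp: rotate_coords_def seq_scale_def zero_prod_def zero_fun_def
          intro!: lp_space_finite_support[of "{}"])
  next
    case (step c v y)
    then obtain n where v: "v = (T ^^ (j * n)) x" by (auto simp: orbit)
    have vin: "v \<in> lp_space p" unfolding v by (rule bilateral_shift_power_lp_space[OF T x])
    have cv: "seq_scale c v \<in> lp_space p" by (rule lp_space_scale[OF p vin])
    have v1: "(v, rotate_coords \<omega> v) \<in> M"
      using gen[of "j * n"] \<omega>(2) by (simp add: v power_mult seq_scale_def)
    have v2: "(T v, seq_scale \<omega> (rotate_coords \<omega> (T v))) \<in> M"
      using gen[of "Suc (j * n)"] \<omega>(2) by (simp add: v power_mult)
    have "sum_scale seq_scale c (v, rotate_coords \<omega> v) + (y, rotate_coords \<omega> y) \<in> M"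
      using v1 step.IH unfolding M_def by (intro W.span_add W.span_scale) auto
    moreover have "sum_scale seq_scale c (T v, seq_scale \<omega> (rotate_coords \<omega> (T v)))
        + (T y, seq_scale \<omega> (rotate_coords \<omega> (T y))) \<in> M"
      using v2 step.IH unfolding M_def by (intro W.span_add W.span_scale) auto
    moreover have "T (seq_scale c v + y) = seq_scale c (T v) + T y"
      using B cv vin step.IH by (simp add: lp_bounded_operator_def)
    moreover define s where "s = seq_scale c v + y"
    ultimately have "(s, rotate_coords \<omega> s) \<in> M"
        "(T s, seq_scale \<omega> (rotate_coords \<omega> (T s))) \<in> M"
      by (simp_all add: sum_scale_def rotate_coords_add rotate_coords_scale V.scale_right_distrib
          mult.commute)
    moreover have "s \<in> lp_space p" using lp_space_add[OF p cv] step.IH by (simp add: s_def)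
    ultimately show ?case unfolding s_def by blast
  qed
qed

lemma in_closure_of_prod_lp_topology:
  assumes p: "1 \<le> p" and a: "a \<in> lp_space p" and b: "b \<in> lp_space p"
    and approx: "\<And>e. 0 < e \<Longrightarrow> \<exists>c d. (c, d) \<in> S \<and> c \<in> lp_space p \<and> d \<in> lp_space p
        \<and> lp_norm p (a - c) < e \<and> lp_norm p (b - d) < e"
  shows "(a, b) \<in> prod_topology (lp_topology p) (lp_topology p) closure_of S"
  unfolding in_closure_of
proof (intro conjI allI impI)
  interpret Metric_space "lp_space p" "\<lambda>x y. lp_norm p (x - y)" by (rule Metric_space_lp[OF p])
  show "(a, b) \<in> topspace (prod_topology (lp_topology p) (lp_topology p))"
    using a b by (simp add: topspace_lp_topology[OF p])
  fix G assume "(a, b) \<in> G \<and> openin (prod_topology (lp_topology p) (lp_topology p)) G"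
  then obtain U U' where U: "openin (lp_topology p) U" "a \<in> U"
    and U': "openin (lp_topology p) U'" "b \<in> U'" and G: "U \<times> U' \<subseteq> G"
    unfolding openin_prod_topology_alt by metis
  obtain r where r: "r > 0" "mball a r \<subseteq> U"
    using U unfolding lp_topology_def openin_mtopology by blast
  obtain r' where r': "r' > 0" "mball b r' \<subseteq> U'"
    using U' unfolding lp_topology_def openin_mtopology by blast
  obtain c d where cd: "(c, d) \<in> S" "c \<in> lp_space p" "d \<in> lp_space p"
      "lp_norm p (a - c) < min r r'" "lp_norm p (b - d) < min r r'"
    using approx[of "min r r'"] r(1) r'(1) by auto
  then have "c \<in> mball a r" "d \<in> mball b r'" using a b by (auto simp: in_mball)
  then show "\<exists>y. y \<in> S \<and> y \<in> G" using cd(1) r r' G by blast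
qed

text \<open>A continuous map with dense range maps dense sets to dense sets.\<close>

lemma bilateral_shift_image_dense:
  assumes p: "1 \<le> p" and T: "weighted_bilateral_shift p w T" and Q: "Q \<subseteq> lp_space p"
    and dense: "\<And>y e. y \<in> lp_space p \<Longrightarrow> 0 < e \<Longrightarrow> \<exists>q\<in>Q. lp_norm p (y - q) < e"
    and u: "u \<in> lp_space p" and e: "0 < e"
  shows "\<exists>q\<in>Q. lp_norm p (u - T q) < e"
proof -
  have B: "lp_bounded_operator p T" using T by (simp add: weighted_bilateral_shift_def)
  obtain K where K: "K > 0" "\<And>x. x \<in> lp_space p \<Longrightarrow> lp_norm p (T x) \<le> K * lp_norm p x"
    using lp_bounded_operator_pos_bound[OF B] by blast
  obtain z where z: "z \<in> lp_space p" "lp_norm p (u - T z) < e / 2"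
    using bilateral_shift_dense_range[OF p T u, of "e / 2"] e by auto
  obtain q where q: "q \<in> Q" "lp_norm p (z - q) < e / (2 * K)"
    using dense[OF z(1), of "e / (2 * K)"] e K(1) by auto
  have qin: "q \<in> lp_space p" using q(1) Q by blast
  have TV: "T v \<in> lp_space p" if "v \<in> lp_space p" for v
    using B that unfolding lp_bounded_operator_def by blast
  have eq: "u - T q = (u - T z) + T (z - q)"
    by (simp add: lp_bounded_operator_diff[OF p B z(1) qin])
  have "lp_norm p (u - T q) \<le> lp_norm p (u - T z) + lp_norm p (T (z - q))"
    unfolding eq
    by (intro lp_norm_triangle lp_space_add lp_space_diff p u TV z(1) qin)
  moreover have "lp_norm p (T (z - q)) < e / 2"
    using K(2)[OF lp_space_diff[OF p z(1) qin]] mult_strict_left_mono[OF q(2) K(1)] K(1)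
    by simp
  ultimately show ?thesis using z(2) q(1) by (intro bexI[of _ q]) auto
qed

theorem corollary2p5:
  fixes p :: ereal and w :: "int \<Rightarrow> complex"
    and T :: "(int \<Rightarrow> complex) \<Rightarrow> (int \<Rightarrow> complex)"
  assumes "1 \<le> p"
    and "weighted_bilateral_shift p w T"
    and "\<exists>j::nat. j \<ge> 2 \<and> cyclic_operator seq_scale (lp_topology p) (T ^^ j)"
  shows "cyclic_operator (sum_scale seq_scale)
           (prod_topology (lp_topology p) (lp_topology p)) (map_prod T T)"
proof -
  note p = assms(1) and T = assms(2)
  have B: "lp_bounded_operator p T" using T by (simp add: weighted_bilateral_shift_def)
  obtain j x where j: "j \<ge> 2" and x: "x \<in> lp_space p"
    and cyc: "lp_topology p closure_of (module.span seq_scale {((T ^^ j) ^^ n) x | n. True})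
      = lp_space p"
    using assms(3) unfolding cyclic_operator_def topspace_lp_topology[OF p] by blast
  define \<omega> where "\<omega> = exp (2 * of_real pi * \<i> * of_nat 1 / of_nat j)"
  have \<omega>: "\<omega> ^ j = 1" "\<omega> \<noteq> 1"
    using j complex_root_unity[of j 1] complex_root_unity_eq_1[of j 1] by (auto simp: \<omega>_def)
  have \<omega>1: "cmod \<omega> = 1" using \<omega>(1) j by (metis not_numeral_le_zero norm_one norm_power
        power_eq_1_iff norm_ge_zero)
  have \<omega>0: "\<omega> \<noteq> 0" using \<omega>1 by auto
  let ?D = "rotate_coords \<omega>"
  define Q where "Q = module.span seq_scale {((T ^^ j) ^^ n) x | n. True}"
  define M where "M = module.span (sum_scale seq_scale)
                  {(map_prod T T ^^ n) (x, ?D x) | n. True}"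
  have Q: "q \<in> lp_space p" "(q, ?D q) \<in> M" "(T q, seq_scale \<omega> (?D (T q))) \<in> M" if "q \<in> Q" for q
    using orbit_span_pairs[OF p T \<omega>1 \<omega>(1) x] that unfolding Q_def M_def by blast+
  have dense: "\<exists>q\<in>Q. lp_norm p (y - q) < e" if "y \<in> lp_space p" "0 < e" for y e
  proof -
    interpret Metric_space "lp_space p" "\<lambda>x y. lp_norm p (x - y)" by (rule Metric_space_lp[OF p])
    have "y \<in> mtopology closure_of Q" using cyc that(1) by (simp add: lp_topology_def Q_def)
    then show ?thesis using that(2) by (force simp: metric_closure_of in_mball)
  qed
  interpret W: vector_space "sum_scale seq_scale"
    by (rule vector_space_sum_scale[OF vector_space_seq_scale])
  have approx: "\<exists>c d. (c, d) \<in> M \<and> c \<in> lp_space p \<and> d \<in> lp_space p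
        \<and> lp_norm p (a - c) < e \<and> lp_norm p (b - d) < e"
    if a: "a \<in> lp_space p" and b: "b \<in> lp_space p" and e: "0 < e" for a b e
  proof -
    \<comment> \<open>Solve \<open>y + u = a\<close> and \<open>y + \<omega> u = b'\<close>, where \<open>b'\<close> is the preimage of \<open>b\<close> under the
      rotation; subtracting gives \<open>(1 - \<omega>) u = a - b'\<close>.\<close>
    define b' where "b' = rotate_coords (inverse \<omega>) b"
    have b': "b' \<in> lp_space p" "?D b' = b"
      using b p \<omega>1 \<omega>0 rotate_coords_lp_space[of "inverse \<omega>" p b]
      by (auto simp: b'_def norm_inverse rotate_coords_inverse)
    define u where "u = seq_scale (1 / (1 - \<omega>)) (a - b')"
    define y where "y = a - u"
    have u: "u \<in> lp_space p" unfolding u_def by (intro lp_space_scale lp_space_diff p a b'(1))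
    have y: "y \<in> lp_space p" unfolding y_def by (intro lp_space_diff p a u)
    have sol: "b' = y + seq_scale \<omega> u"
    proof
      fix n
      have "(1 - \<omega>) * u n = a n - b' n" using \<omega>(2) by (simp add: u_def seq_scale_def)
      then show "b' n = (y + seq_scale \<omega> u) n"
        by (simp add: y_def seq_scale_def algebra_simps)
    qed
    obtain q1 where q1: "q1 \<in> Q" "lp_norm p (y - q1) < e / 2"
      using dense[OF y, of "e / 2"] e by auto
    obtain q2 where q2: "q2 \<in> Q" "lp_norm p (u - T q2) < e / 2"
      using bilateral_shift_image_dense[OF p T _ dense u, of "e / 2"] e Q(1) by auto
    define c where "c = q1 + T q2"
    define d where "d = ?D (q1 + seq_scale \<omega> (T q2))"
    have Tq2: "T q2 \<in> lp_space p"
      using B Q(1)[OF q2(1)] unfolding lp_bounded_operator_def by blast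
    have sTq2: "seq_scale \<omega> (T q2) \<in> lp_space p" by (rule lp_space_scale[OF p Tq2])
    note in_lp = lp_space_add[OF p] lp_space_diff[OF p] lp_space_scale[OF p]
      rotate_coords_lp_space[OF \<omega>1 p] Q(1)[OF q1(1)] Tq2 y u
    have "(q1, ?D q1) + (T q2, seq_scale \<omega> (?D (T q2))) \<in> M"
      using Q q1(1) q2(1) unfolding M_def by (intro W.span_add) auto
    then have "(c, d) \<in> M" by (simp add: c_def d_def rotate_coords_add rotate_coords_scale)
    moreover have "c \<in> lp_space p" "d \<in> lp_space p" unfolding c_def d_def by (intro in_lp)+
    moreover have "lp_norm p (a - c) < e"
    proof -
      have "a - c = (y - q1) + (u - T q2)" by (simp add: c_def y_def)
      then have "lp_norm p (a - c) \<le> lp_norm p (y - q1) + lp_norm p (u - T q2)"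
        using lp_norm_triangle[OF p, of "y - q1" "u - T q2"] in_lp by simp
      then show ?thesis using q1(2) q2(2) by simp
    qed
    moreover have "lp_norm p (b - d) < e"
    proof -
      define v where "v = seq_scale \<omega> (u - T q2)"
      have v: "v \<in> lp_space p" unfolding v_def by (intro in_lp)
      have "lp_norm p v \<le> 1 * lp_norm p (u - T q2)"
        by (rule lp_norm_dominated[OF p]) (auto intro!: in_lp simp: v_def seq_scale_def norm_mult \<omega>1)
      moreover have "b - d = ?D ((y - q1) + v)"
      proof -
        have "b - d = ?D (b' - (q1 + seq_scale \<omega> (T q2)))"
          by (simp add: d_def b'(2) rotate_coords_diff)
        also have "b' - (q1 + seq_scale \<omega> (T q2)) = (y - q1) + v"
          by (simp add: sol v_def seq_scale_def fun_eq_iff algebra_simps)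
        finally show ?thesis .
      qed
      moreover have "lp_norm p (?D ((y - q1) + v)) \<le> lp_norm p ((y - q1) + v)"
        by (intro rotate_coords_lp_norm_le \<omega>1 p in_lp v)
      moreover have "lp_norm p ((y - q1) + v) \<le> lp_norm p (y - q1) + lp_norm p v"
        by (intro lp_norm_triangle p in_lp v)
      ultimately show ?thesis using q1(2) q2(2) by simp
    qed
    ultimately show ?thesis by blast
  qed
  let ?X = "prod_topology (lp_topology p) (lp_topology p)"
  have "topspace ?X \<subseteq> ?X closure_of M"
    using in_closure_of_prod_lp_topology[OF p _ _ approx] by (auto simp: topspace_lp_topology[OF p])
  then have "?X closure_of M = topspace ?X" by (intro equalityI closure_of_subset_topspace)
  moreover have "(x, ?D x) \<in> topspace ?X"
    using x rotate_coords_lp_space[OF \<omega>1 p x] by (simp add: topspace_lp_topology[OF p])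
  ultimately show ?thesis unfolding cyclic_operator_def M_def by blast
qed

end
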